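(* Let $\sigma$ be the one-dimensional real sign representation of $C_2$. For all integers $k\ge 0$ and $\epsilon\in\{0,1\}$, the space $\mathrm{Emb}^{C_2}(kC_2+\epsilon C_2/C_2,\sigma)$ of structure maps is a homotopy discrete $\mathrm{Aut}^{C_2}(kC_2)$-torsor: $$\mathrm{Emb}^{C_2}(kC_2,\sigma)\simeq\mathrm{Aut}^{C_2}(kC_2).$$
   Context: $kC_2+\epsilon C_2/C_2$ denotes the finite $C_2$-set that is the disjoint union of $k$ free orbits and $\epsilon$ fixed points. For a finite $C_2$-set $T$, $\mathrm{Emb}^{C_2}(T,\sigma)$ is the space of $C_2$-equivariant embeddings (injective maps) $T\to\sigma$; for an algebra $X$ over the little disks operad of $\sigma$ it parameterizes the structure maps $\mathrm{Map}(T,X)\to X$. $\mathrm{Aut}^{C_2}(kC_2)$ is the group of $C_2$-equivariant automorphisms of $kC_2$, acting on the embedding space by precomposition (extended by the identity on the fixed point if $\epsilon=1$). "Homotopy discrete" means that each path component is contractible. *)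

theory Defs
  imports "HOL-Analysis.Homotopy" "HOL-Algebra.Group_Action" "HOL-Algebra.Elementary_Groups"
begin

section \<open>Equivariant maps, automorphisms and embeddings\<close>

definition equivariant ::
    "('g, 'm) monoid_scheme \<Rightarrow> 'a set \<Rightarrow> ('g \<Rightarrow> 'a \<Rightarrow> 'a) \<Rightarrow> ('g \<Rightarrow> 'b \<Rightarrow> 'b) \<Rightarrow> ('a \<Rightarrow> 'b) \<Rightarrow> bool"
  where "equivariant G T \<phi> \<psi> f \<longleftrightarrow> (\<forall>g\<in>carrier G. \<forall>t\<in>T. f (\<phi> g t) = \<psi> g (f t))"

definition equivariant_Aut ::
    "('g, 'm) monoid_scheme \<Rightarrow> 'a set \<Rightarrow> ('g \<Rightarrow> 'a \<Rightarrow> 'a) \<Rightarrow> ('a \<Rightarrow> 'a) monoid"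
  where "equivariant_Aut G T \<phi> =
    (BijGroup T)\<lparr>carrier := {a \<in> Bij T. equivariant G T \<phi> \<phi> a}\<rparr>"

text \<open>
  Maps are extensional on \<open>T\<close>. As \<open>T\<close> is a finite discrete set, the mapping space topology is
  the product topology, and the space of embeddings is a subspace of it.
\<close>

definition equivariant_Emb ::
    "('g, 'm) monoid_scheme \<Rightarrow> 'a set \<Rightarrow> ('g \<Rightarrow> 'a \<Rightarrow> 'a) \<Rightarrow>
     'b topology \<Rightarrow> ('g \<Rightarrow> 'b \<Rightarrow> 'b) \<Rightarrow> ('a \<Rightarrow> 'b) topology"
  where "equivariant_Emb G T \<phi> Y \<psi> =
    subtopology (product_topology (\<lambda>_. Y) T)
      {f \<in> T \<rightarrow>\<^sub>E topspace Y. inj_on f T \<and> equivariant G T \<phi> \<psi> f}"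


section \<open>Homotopy discrete torsors\<close>

definition homotopy_discrete :: "'a topology \<Rightarrow> bool"
  where "homotopy_discrete X \<longleftrightarrow>
    (\<forall>C\<in>path_components_of X. contractible_space (subtopology X C))"

text \<open>The group is discrete, so continuity of the action is continuity of each translation.\<close>

definition continuous_right_action ::
    "('g, 'm) monoid_scheme \<Rightarrow> 'a topology \<Rightarrow> ('a \<Rightarrow> 'g \<Rightarrow> 'a) \<Rightarrow> bool"
  where "continuous_right_action G X act \<longleftrightarrow>
    group G \<and>
    (\<forall>a\<in>carrier G. continuous_map X X (\<lambda>x. act x a)) \<and>
    (\<forall>x\<in>topspace X. act x \<one>\<^bsub>G\<^esub> = x) \<and>
    (\<forall>x\<in>topspace X. \<forall>a\<in>carrier G. \<forall>b\<in>carrier G. act x (a \<otimes>\<^bsub>G\<^esub> b) = act (act x a) b)"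

text \<open>
  The torsor condition up to homotopy: every path component is contractible, and the set of path
  components is nonempty with a simply transitive induced action (each translation is a
  homeomorphism, so it maps path components onto path components).
\<close>

definition homotopy_discrete_torsor ::
    "('g, 'm) monoid_scheme \<Rightarrow> 'a topology \<Rightarrow> ('a \<Rightarrow> 'g \<Rightarrow> 'a) \<Rightarrow> bool"
  where "homotopy_discrete_torsor G X act \<longleftrightarrow>
    continuous_right_action G X act \<and>
    homotopy_discrete X \<and>
    path_components_of X \<noteq> {} \<and>
    (\<forall>C\<in>path_components_of X. \<forall>D\<in>path_components_of X.
       \<exists>!a. a \<in> carrier G \<and> (\<lambda>x. act x a) ` C = D)"


section \<open>The group of order two, its finite sets and its sign representation\<close>

abbreviation C2 :: "int monoid"
  where "C2 \<equiv> integer_mod_group 2"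

text \<open>
  The set \<open>k C2 + \<epsilon> C2/C2\<close>: \<open>Inl (i, h)\<close> is the element \<open>h\<close> of the \<open>i\<close>-th copy of \<open>C2\<close>, on which
  \<open>C2\<close> acts by translation, and \<open>Inr j\<close> is the \<open>j\<close>-th fixed point.
\<close>

definition C2_set :: "nat \<Rightarrow> nat \<Rightarrow> (nat \<times> int + nat) set"
  where "C2_set k \<epsilon> = ({..<k} \<times> carrier C2) <+> {..<\<epsilon>}"

definition C2_set_action :: "nat \<Rightarrow> nat \<Rightarrow> int \<Rightarrow> nat \<times> int + nat \<Rightarrow> nat \<times> int + nat"
  where "C2_set_action k \<epsilon> g =
    (\<lambda>t\<in>C2_set k \<epsilon>. case t of Inl (i, h) \<Rightarrow> Inl (i, g \<otimes>\<^bsub>C2\<^esub> h) | Inr j \<Rightarrow> Inr j)"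

definition sign_rep :: "int \<Rightarrow> real \<Rightarrow> real"
  where "sign_rep g x = (if g = \<one>\<^bsub>C2\<^esub> then x else - x)"

definition Aut_free :: "nat \<Rightarrow> (nat \<times> int + nat \<Rightarrow> nat \<times> int + nat) monoid"
  where "Aut_free k = equivariant_Aut C2 (C2_set k 0) (C2_set_action k 0)"

definition Emb_sign :: "nat \<Rightarrow> nat \<Rightarrow> (nat \<times> int + nat \<Rightarrow> real) topology"
  where "Emb_sign k \<epsilon> =
    equivariant_Emb C2 (C2_set k \<epsilon>) (C2_set_action k \<epsilon>) euclideanreal sign_rep"

text \<open>Extension of an automorphism of the free part by the identity on the fixed points.\<close>

definition extend_by_id ::
    "nat \<Rightarrow> (nat \<times> int + nat \<Rightarrow> nat \<times> int + nat) \<Rightarrow> nat \<times> int + nat \<Rightarrow> nat \<times> int + nat"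
  where "extend_by_id k a t = (if t \<in> C2_set k 0 then a t else t)"

definition precompose ::
    "nat \<Rightarrow> nat \<Rightarrow> (nat \<times> int + nat \<Rightarrow> real) \<Rightarrow> (nat \<times> int + nat \<Rightarrow> nat \<times> int + nat) \<Rightarrow>
     nat \<times> int + nat \<Rightarrow> real"
  where "precompose k \<epsilon> f a = compose (C2_set k \<epsilon>) f (extend_by_id k a)"

lemma carrier_C2: "carrier C2 = {0, 1}"
  by (auto simp: carrier_integer_mod_group)

lemma mult_C2: "g \<otimes>\<^bsub>C2\<^esub> h = (g + h) mod 2"
  by (simp add: integer_mod_group_def)

lemma C2_set_action_closed:
  assumes "g \<in> carrier C2" "t \<in> C2_set k \<epsilon>"
  shows "C2_set_action k \<epsilon> g t \<in> C2_set k \<epsilon>"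
  using assms by (auto simp: C2_set_action_def C2_set_def carrier_C2 mult_C2)

lemma C2_set_action_mult:
  assumes "g \<in> carrier C2" "h \<in> carrier C2" "t \<in> C2_set k \<epsilon>"
  shows "C2_set_action k \<epsilon> (g \<otimes>\<^bsub>C2\<^esub> h) t = C2_set_action k \<epsilon> g (C2_set_action k \<epsilon> h t)"
  using assms by (auto simp: C2_set_action_def C2_set_def carrier_C2 mult_C2)

lemma C2_set_action_Bij:
  assumes "g \<in> carrier C2"
  shows "C2_set_action k \<epsilon> g \<in> Bij (C2_set k \<epsilon>)"
proof -
  have inv: "C2_set_action k \<epsilon> g (C2_set_action k \<epsilon> g t) = t" if "t \<in> C2_set k \<epsilon>" for t
    using assms that by (auto simp: C2_set_action_def C2_set_def carrier_C2 mult_C2)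
  have "bij_betw (C2_set_action k \<epsilon> g) (C2_set k \<epsilon>) (C2_set k \<epsilon>)"
    by (rule bij_betw_byWitness[where f' = "C2_set_action k \<epsilon> g"])
       (use inv assms C2_set_action_closed in auto)
  moreover have "C2_set_action k \<epsilon> g \<in> extensional (C2_set k \<epsilon>)"
    by (simp add: C2_set_action_def)
  ultimately show ?thesis
    by (simp add: Bij_def)
qed

lemma group_action_C2_set: "group_action C2 (C2_set k \<epsilon>) (C2_set_action k \<epsilon>)"
proof -
  have "C2_set_action k \<epsilon> (g \<otimes>\<^bsub>C2\<^esub> h) =
        compose (C2_set k \<epsilon>) (C2_set_action k \<epsilon> g) (C2_set_action k \<epsilon> h)"
    if "g \<in> carrier C2" "h \<in> carrier C2" for g h
  proof (rule extensionalityI[where A = "C2_set k \<epsilon>"])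
    show "C2_set_action k \<epsilon> (g \<otimes>\<^bsub>C2\<^esub> h) \<in> extensional (C2_set k \<epsilon>)"
      by (simp add: C2_set_action_def)
  qed (use that C2_set_action_mult in \<open>auto simp: compose_eq\<close>)
  then show ?thesis
    unfolding group_action_def group_hom_def group_hom_axioms_def hom_def
    by (auto simp: group_BijGroup C2_set_action_Bij) (auto simp: BijGroup_def C2_set_action_Bij)
qed

lemma group_action_sign_rep: "group_action C2 UNIV sign_rep"
proof -
  have bij: "sign_rep g \<in> Bij UNIV" for g
    by (auto simp: Bij_def extensional_def sign_rep_def intro!: bij_betw_byWitness[where f' = "sign_rep g"])
  have "sign_rep (g \<otimes>\<^bsub>C2\<^esub> h) = compose UNIV (sign_rep g) (sign_rep h)"
    if "g \<in> carrier C2" "h \<in> carrier C2" for g h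
    using that by (auto simp: compose_def sign_rep_def carrier_C2 mult_C2 fun_eq_iff)
  with bij show ?thesis
    unfolding group_action_def group_hom_def group_hom_axioms_def hom_def
    by (auto simp: group_BijGroup) (auto simp: BijGroup_def)
qed

end

theory Submission
  imports Defs
begin

text \<open>
  An equivariant embedding \<open>f\<close> of \<open>T = k C\<^sub>2 + \<epsilon> C\<^sub>2/C\<^sub>2\<close> into the sign representation is an injective
  real function that is odd under the involution \<open>flip\<close> of \<open>T\<close>. Up to homotopy it amounts to the
  linear order that it induces on \<open>T\<close>: the embeddings inducing a given order form an
  open convex piece, and the automorphisms of the free part permute these orders simply
  transitively.

  The order induced by \<open>f\<close> is recorded by \<open>signed_rank T f\<close>, which sends \<open>t\<close> to the number of
  points below \<open>t\<close> minus the number of points above \<open>t\<close>. This invariant has three virtues.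

  \<^item> It determines the order, and it is constant near \<open>f\<close>, because the finitely many strict
    inequalities between values of \<open>f\<close> persist under small perturbations
    (\<open>continuous_map_signed_rank\<close>). Strict inequalities and oddness both survive
    convex combination, so its level sets are contractible (\<open>contractible_signed_rank_fibre\<close>).

  \<^item> Reversing the order changes its sign, so it is again odd under \<open>flip\<close> (\<open>signed_rank_flip\<close>).

  \<^item> For injective \<open>f\<close> it is a bijection of \<open>T\<close> onto a set of integers depending only on the
    cardinality of \<open>T\<close> (\<open>bij_betw_signed_rank\<close>). For two embeddings \<open>f\<close> and \<open>g\<close> there is
    therefore exactly one permutation \<open>\<sigma>\<close> of \<open>T\<close> with
    \<open>signed_rank T f \<circ> \<sigma> = signed_rank T g\<close>. By oddness \<open>\<sigma>\<close> commutes with \<open>flip\<close>, hence it preserves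
    the free part, and it fixes the at most one fixed point
    (\<open>signed_rank_simply_transitive\<close>).

  The topological half, \<open>torsor_of_fibrewise_simply_transitive\<close>, says that a locally constant
  invariant with contractible fibres, on whose values a group acts simply transitively, exhibits
  a space as a homotopy discrete torsor, equivalent to the discrete group.
\<close>

section \<open>Locally constant maps with contractible fibres\<close>

abbreviation fibre :: "'a topology \<Rightarrow> ('a \<Rightarrow> 'r) \<Rightarrow> 'r \<Rightarrow> 'a set"
  where "fibre X \<rho> r \<equiv> {x \<in> topspace X. \<rho> x = r}"

lemma openin_fibre:
  assumes "continuous_map X (discrete_topology UNIV) \<rho>"
  shows "openin X (fibre X \<rho> r)"
  using openin_continuous_map_preimage[OF assms, of "{r}"] by simp

text \<open>
  A path component is connected, so its image in a discrete space is a single point; it therefore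
  lies in one fibre, and a path connected fibre lies in one path component.
\<close>

lemma path_components_of_eq_fibres:
  assumes cont: "continuous_map X (discrete_topology UNIV) \<rho>"
    and path: "\<And>r. path_connectedin X (fibre X \<rho> r)"
  shows "path_components_of X = fibre X \<rho> ` \<rho> ` topspace X"
proof -
  have "path_component_of_set X x = fibre X \<rho> (\<rho> x)" if x: "x \<in> topspace X" for x
  proof
    have "connectedin X (path_component_of_set X x)"
      by (simp add: path_connectedin_path_component_of path_connectedin_imp_connectedin)
    then have "connectedin (discrete_topology UNIV) (\<rho> ` path_component_of_set X x)"
      using cont connectedin_continuous_map_image by blast
    then obtain r where r: "\<rho> ` path_component_of_set X x \<subseteq> {r}"
      by (auto simp: connectedin_discrete_topology)
    moreover have "x \<in> path_component_of_set X x"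
      using x by (simp add: path_component_of_refl)
    ultimately have "\<rho> y = \<rho> x" if "y \<in> path_component_of_set X x" for y
      using that by (metis image_subset_iff singletonD)
    then show "path_component_of_set X x \<subseteq> fibre X \<rho> (\<rho> x)"
      using path_component_of_subset_topspace[of X x] by auto
    show "fibre X \<rho> (\<rho> x) \<subseteq> path_component_of_set X x"
      by (rule path_component_of_maximal) (use path x in auto)
  qed
  then show ?thesis
    by (auto simp: path_components_of_def image_image)
qed

text \<open>
  The fibres are open and disjoint, so homotopies chosen independently on them glue.
\<close>

lemma homotopic_with_fibrewise:
  assumes cont: "continuous_map X (discrete_topology UNIV) \<rho>"
    and hom: "\<And>r. homotopic_with (\<lambda>_. True) (subtopology X (fibre X \<rho> r)) Y f g"
  shows "homotopic_with (\<lambda>_. True) X Y f g"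
proof -
  let ?I = "top_of_set {0..1::real}"
  have "\<forall>r. \<exists>h. continuous_map (prod_topology ?I (subtopology X (fibre X \<rho> r))) Y h \<and>
               (\<forall>x. h (0, x) = f x) \<and> (\<forall>x. h (1, x) = g x)"
    using hom by (simp add: homotopic_with_def)
  then obtain h where h: "\<And>r. continuous_map (prod_topology ?I (subtopology X (fibre X \<rho> r))) Y (h r)"
    and h0: "\<And>r x. h r (0, x) = f x" and h1: "\<And>r x. h r (1, x) = g x"
    by metis
  define H where "H = (\<lambda>(t, x). h (\<rho> x) (t, x))"
  have "continuous_map (prod_topology ?I X) Y H"
  proof (rule pasting_lemma[where I = UNIV and T = "\<lambda>r. {0..1} \<times> fibre X \<rho> r" and f = h])
    show "openin (prod_topology ?I X) ({0..1} \<times> fibre X \<rho> r)" for r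
      using openin_fibre[OF cont] by (simp add: openin_prod_Times_iff)
    show "continuous_map (subtopology (prod_topology ?I X) ({0..1} \<times> fibre X \<rho> r)) Y (h r)" for r
      using h[of r] by (simp add: subtopology_Times subtopology_subtopology)
  qed (auto simp: H_def)
  then show ?thesis
    by (auto simp: homotopic_with_def H_def h0 h1 intro!: exI[of _ H])
qed

text \<open>
  A section of \<open>\<rho>\<close>, automatically continuous on a discrete space, is a homotopy inverse: each
  fibre contracts to the point that the section selects in it.
\<close>

lemma homotopy_equivalent_discrete_fibres:
  assumes cont: "continuous_map X (discrete_topology UNIV) \<rho>"
    and contr: "\<And>r. contractible_space (subtopology X (fibre X \<rho> r))"
  shows "X homotopy_equivalent_space discrete_topology (\<rho> ` topspace X)"
proof -
  let ?R = "\<rho> ` topspace X"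
  define \<sigma> where "\<sigma> = inv_into (topspace X) \<rho>"
  have \<sigma>: "\<sigma> r \<in> topspace X" "\<rho> (\<sigma> r) = r" if "r \<in> ?R" for r
    using that by (simp_all add: \<sigma>_def inv_into_into f_inv_into_f)
  have cont': "continuous_map X (discrete_topology ?R) \<rho>"
    using continuous_map_into_subtopology[OF cont, of ?R] by simp
  have cont_\<sigma>: "continuous_map (discrete_topology ?R) X \<sigma>"
    using \<sigma> by auto
  have "homotopic_with (\<lambda>_. True) (subtopology X (fibre X \<rho> r)) X (\<sigma> \<circ> \<rho>) id" for r
  proof (cases "r \<in> ?R")
    case True
    have "homotopic_with (\<lambda>_. True) (subtopology X (fibre X \<rho> r)) (subtopology X (fibre X \<rho> r)) id (\<lambda>_. \<sigma> r)"
      using contr[of r] \<sigma>[OF True] by (simp add: contractible_space_alt)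
    then have "homotopic_with (\<lambda>_. True) (subtopology X (fibre X \<rho> r)) X id (\<lambda>_. \<sigma> r)"
      by (rule homotopic_with_compose_continuous_map_left[of _ _ _ _ _ _ id, simplified]) simp
    then have "homotopic_with (\<lambda>_. True) (subtopology X (fibre X \<rho> r)) X id (\<sigma> \<circ> \<rho>)"
      by (rule homotopic_with_eq) auto
    then show ?thesis
      by (simp add: homotopic_with_sym)
  next
    case False
    then show ?thesis
      using continuous_map_compose[OF cont' cont_\<sigma>]
      by (intro homotopic_with_equal) (auto intro: continuous_map_from_subtopology)
  qed
  then have "homotopic_with (\<lambda>_. True) X X (\<sigma> \<circ> \<rho>) id"
    by (rule homotopic_with_fibrewise[OF cont])
  moreover have "homotopic_with (\<lambda>_. True) (discrete_topology ?R) (discrete_topology ?R) (\<rho> \<circ> \<sigma>) id"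
    by (rule homotopic_with_equal) (use \<sigma> in auto)
  ultimately show ?thesis
    using cont' cont_\<sigma> unfolding homotopy_equivalent_space_def by blast
qed

text \<open>
  The path components are the fibres of \<open>\<rho>\<close>, and the congruence condition makes the action descend
  to the values of \<open>\<rho>\<close>. The translate of a fibre is then a whole fibre, because the inverse group
  element translates back. For the homotopy equivalence, an orbit map identifies the group with
  the set of values.
\<close>

proposition torsor_of_fibrewise_simply_transitive:
  assumes act: "continuous_right_action G X act"
    and cont: "continuous_map X (discrete_topology UNIV) \<rho>"
    and contr: "\<And>r. contractible_space (subtopology X (fibre X \<rho> r))"
    and cong: "\<And>x y a. \<lbrakk>x \<in> topspace X; y \<in> topspace X; a \<in> carrier G; \<rho> x = \<rho> y\<rbrakk>
      \<Longrightarrow> \<rho> (act x a) = \<rho> (act y a)"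
    and trans: "\<And>x y. \<lbrakk>x \<in> topspace X; y \<in> topspace X\<rbrakk>
      \<Longrightarrow> \<exists>!a. a \<in> carrier G \<and> \<rho> (act x a) = \<rho> y"
    and nonempty: "topspace X \<noteq> {}"
  shows "homotopy_discrete_torsor G X act"
    and "X homotopy_equivalent_space discrete_topology (carrier G)"
proof -
  interpret G: group G
    using act by (simp add: continuous_right_action_def)
  have closed: "act x a \<in> topspace X" if "x \<in> topspace X" "a \<in> carrier G" for x a
    using act that by (auto simp: continuous_right_action_def continuous_map_def)
  have act_inv: "act (act x (inv\<^bsub>G\<^esub> a)) a = x" if "x \<in> topspace X" "a \<in> carrier G" for x a
    using act that G.inv_closed[OF that(2)] G.l_inv[OF that(2)]
    unfolding continuous_right_action_def by metis
  have components: "path_components_of X = fibre X \<rho> ` \<rho> ` topspace X"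
  proof (rule path_components_of_eq_fibres[OF cont])
    show "path_connectedin X (fibre X \<rho> r)" for r
      using contractible_imp_path_connected_space[OF contr[of r]] by (auto simp: path_connectedin_def)
  qed
  have translate: "(\<lambda>z. act z a) ` fibre X \<rho> (\<rho> x) = fibre X \<rho> (\<rho> y) \<longleftrightarrow> \<rho> (act x a) = \<rho> y"
    if x: "x \<in> topspace X" and y: "y \<in> topspace X" and a: "a \<in> carrier G" for x y a
  proof
    assume "(\<lambda>z. act z a) ` fibre X \<rho> (\<rho> x) = fibre X \<rho> (\<rho> y)"
    then show "\<rho> (act x a) = \<rho> y"
      using x by blast
  next
    assume eq: "\<rho> (act x a) = \<rho> y"
    have "z \<in> (\<lambda>z. act z a) ` fibre X \<rho> (\<rho> x)" if z: "z \<in> topspace X" "\<rho> z = \<rho> y" for z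
    proof -
      \<comment> \<open>Translate back by the inverse: \<open>z\<close> and \<open>act x a\<close> have the same value.\<close>
      have "\<rho> (act z (inv\<^bsub>G\<^esub> a)) = \<rho> (act (act x a) (inv\<^bsub>G\<^esub> a))"
        by (rule cong) (use closed z x a eq in simp_all)
      also have "act (act x a) (inv\<^bsub>G\<^esub> a) = x"
        using act_inv[of x "inv\<^bsub>G\<^esub> a"] x a by simp
      finally show ?thesis
        using act_inv[of z a] closed[of z "inv\<^bsub>G\<^esub> a"] z a
        by (intro image_eqI[where x = "act z (inv\<^bsub>G\<^esub> a)"]) auto
    qed
    moreover have "act z a \<in> fibre X \<rho> (\<rho> y)" if "z \<in> fibre X \<rho> (\<rho> x)" for z
      using that closed[of z a] cong[of z x a] x a eq by simp
    ultimately show "(\<lambda>z. act z a) ` fibre X \<rho> (\<rho> x) = fibre X \<rho> (\<rho> y)"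
      by (intro equalityI image_subsetI subsetI) simp_all
  qed
  have "\<exists>!a. a \<in> carrier G \<and> (\<lambda>z. act z a) ` C = D"
    if C: "C \<in> path_components_of X" and D: "D \<in> path_components_of X" for C D
  proof -
    from C obtain x where x: "x \<in> topspace X" "C = fibre X \<rho> (\<rho> x)"
      by (auto simp: components)
    from D obtain y where y: "y \<in> topspace X" "D = fibre X \<rho> (\<rho> y)"
      by (auto simp: components)
    show ?thesis
      using trans[OF x(1) y(1)] translate[OF x(1) y(1)] x(2) y(2) by metis
  qed
  then show "homotopy_discrete_torsor G X act"
    using act contr nonempty
    by (auto simp: homotopy_discrete_torsor_def homotopy_discrete_def components)

  obtain x where x: "x \<in> topspace X"
    using nonempty by blast
  have "bij_betw (\<lambda>a. \<rho> (act x a)) (carrier G) (\<rho> ` topspace X)"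
    unfolding bij_betw_def
  proof (intro conjI inj_onI equalityI subsetI)
    show "a = b" if "a \<in> carrier G" "b \<in> carrier G" "\<rho> (act x a) = \<rho> (act x b)" for a b
      using trans[OF x closed[OF x that(2)]] that by blast
    show "r \<in> (\<lambda>a. \<rho> (act x a)) ` carrier G" if "r \<in> \<rho> ` topspace X" for r
      using that trans[OF x] by force
  qed (use closed x in auto)
  then have "homeomorphic_map (discrete_topology (carrier G)) (discrete_topology (\<rho> ` topspace X))
      (\<lambda>a. \<rho> (act x a))"
    unfolding bij_betw_def using closed[OF x]
    by (intro bijective_open_imp_homeomorphic_map) (auto simp: open_map_into_discrete_topology)
  then have "discrete_topology (\<rho> ` topspace X) homotopy_equivalent_space discrete_topology (carrier G)"
    by (meson homeomorphic_map_imp_homeomorphic_space homeomorphic_imp_homotopy_equivalent_space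
        homotopy_equivalent_space_sym)
  then show "X homotopy_equivalent_space discrete_topology (carrier G)"
    using homotopy_equivalent_discrete_fibres[OF cont contr] homotopy_eqv_trans by blast
qed


section \<open>The symmetric rank of a point under a map into a linear order\<close>

text \<open>
  Counting from both ends makes the rank antisymmetric under reversal of the order
  (\<open>signed_rank_uminus\<close>); the plain count of smaller points would only be so up to
  a shift.
\<close>

definition signed_rank :: "'a set \<Rightarrow> ('a \<Rightarrow> 'b::linorder) \<Rightarrow> 'a \<Rightarrow> int"
  where "signed_rank T f t = int (card {s \<in> T. f s < f t}) - int (card {s \<in> T. f t < f s})"

lemma signed_rank_cong:
  assumes "\<And>s t. \<lbrakk>s \<in> T; t \<in> T\<rbrakk> \<Longrightarrow> f s < f t \<longleftrightarrow> g s < g t" "t \<in> T"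
  shows "signed_rank T f t = signed_rank T g t"
proof -
  have "{s \<in> T. f s < f t} = {s \<in> T. g s < g t}" "{s \<in> T. f t < f s} = {s \<in> T. g t < g s}"
    using assms by auto
  then show ?thesis
    by (simp add: signed_rank_def)
qed

lemma signed_rank_less_iff:
  assumes "finite T" "s \<in> T" "t \<in> T"
  shows "signed_rank T f s < signed_rank T f t \<longleftrightarrow> f s < f t"
proof -
  have mono: "signed_rank T f u < signed_rank T f v" if "u \<in> T" "v \<in> T" "f u < f v" for u v
  proof -
    have "card {s \<in> T. f s < f u} < card {s \<in> T. f s < f v}"
      by (rule psubset_card_mono) (use that assms(1) in auto)
    moreover have "card {s \<in> T. f v < f s} \<le> card {s \<in> T. f u < f s}"
      by (rule card_mono) (use that assms(1) in auto)
    ultimately show ?thesis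
      by (simp add: signed_rank_def)
  qed
  have "signed_rank T f s = signed_rank T f t" if "f s = f t"
    using that by (simp add: signed_rank_def)
  then show ?thesis
    using mono[OF assms(2,3)] mono[OF assms(3,2)] by (metis less_asym' linorder_less_linear)
qed

lemma signed_rank_eq_imp_less_iff:
  assumes "finite T" "\<And>t. t \<in> T \<Longrightarrow> signed_rank T f t = signed_rank T g t" "s \<in> T" "t \<in> T"
  shows "f s < f t \<longleftrightarrow> g s < g t"
  using assms by (metis signed_rank_less_iff)

lemma signed_rank_reindex:
  assumes "bij_betw \<sigma> T T"
  shows "signed_rank T (\<lambda>t. f (\<sigma> t)) t = signed_rank T f (\<sigma> t)"
proof -
  have card_eq: "card {s \<in> T. P (\<sigma> s)} = card {s \<in> T. P s}" for P
  proof (rule bij_betw_same_card)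
    show "bij_betw \<sigma> {s \<in> T. P (\<sigma> s)} {s \<in> T. P s}"
      using assms by (auto simp: bij_betw_def inj_on_def)
  qed
  show ?thesis
    using card_eq[of "\<lambda>s. f s < f (\<sigma> t)"] card_eq[of "\<lambda>s. f (\<sigma> t) < f s"]
    by (simp add: signed_rank_def)
qed

lemma signed_rank_uminus:
  fixes f :: "'a \<Rightarrow> 'b::linordered_idom"
  shows "signed_rank T (\<lambda>t. - f t) t = - signed_rank T f t"
  by (simp add: signed_rank_def)

text \<open>
  If \<open>j\<close> of the \<open>n\<close> points lie below \<open>t\<close>, then \<open>n - 1 - j\<close> lie above it, and the rank is
  \<open>j - (n - 1 - j)\<close>. The rank is injective, and there are only \<open>n\<close> possible values of \<open>j\<close>.
  That the set of ranks is the same for all \<open>f\<close> is what makes different injective functions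
  comparable.
\<close>

lemma bij_betw_signed_rank:
  assumes fin: "finite T" and inj: "inj_on f T"
  shows "bij_betw (signed_rank T f) T ((\<lambda>j. 2 * int j + 1 - int (card T)) ` {..<card T})"
proof -
  let ?below = "\<lambda>t. card {s \<in> T. f s < f t}"
  have rank: "signed_rank T f t = 2 * int (?below t) + 1 - int (card T)" and below: "?below t < card T"
    if t: "t \<in> T" for t
  proof -
    let ?above = "{s \<in> T. f t < f s}"
    have "insert t ({s \<in> T. f s < f t} \<union> ?above) = T"
      using t inj by (auto simp: inj_on_def) (meson linorder_neqE)
    then have "card T = card (insert t ({s \<in> T. f s < f t} \<union> ?above))"
      by (rule arg_cong[OF sym])
    also have "\<dots> = Suc (card ({s \<in> T. f s < f t} \<union> ?above))"
      using fin by (intro card_insert_disjoint) auto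
    also have "card ({s \<in> T. f s < f t} \<union> ?above) = ?below t + card ?above"
      using fin by (intro card_Un_disjoint) auto
    finally have "card T = ?below t + card ?above + 1"
      by simp
    then show "signed_rank T f t = 2 * int (?below t) + 1 - int (card T)" "?below t < card T"
      by (simp_all add: signed_rank_def)
  qed
  have inj_rank: "inj_on (signed_rank T f) T"
  proof (rule inj_onI)
    show "s = t" if "s \<in> T" "t \<in> T" "signed_rank T f s = signed_rank T f t" for s t
    proof (cases "f s" "f t" rule: linorder_cases)
      case equal
      then show ?thesis
        using inj that(1,2) by (simp add: inj_onD)
    qed (use that signed_rank_less_iff[OF fin that(1,2), of f] signed_rank_less_iff[OF fin that(2,1), of f] in simp_all)
  qed
  moreover have "signed_rank T f ` T = (\<lambda>j. 2 * int j + 1 - int (card T)) ` {..<card T}"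
  proof (rule card_subset_eq)
    show "signed_rank T f ` T \<subseteq> (\<lambda>j. 2 * int j + 1 - int (card T)) ` {..<card T}"
      using rank below by auto
    show "card (signed_rank T f ` T) = card ((\<lambda>j. 2 * int j + 1 - int (card T)) ` {..<card T})"
      unfolding card_image[OF inj_rank] by (subst card_image) (simp_all add: inj_on_def)
  qed auto
  ultimately show ?thesis
    by (simp add: bij_betw_def)
qed


section \<open>Spaces of injective functions on a finite set\<close>

text \<open>
  The finitely many strict inequalities satisfied by \<open>f\<close> define a neighbourhood of \<open>f\<close>. For
  injective \<open>f\<close> they decide every comparison, so the whole order is constant there.
\<close>

lemma continuous_map_signed_rank:
  fixes S :: "('a \<Rightarrow> real) set"
  assumes fin: "finite T" and inj: "\<And>f. f \<in> S \<Longrightarrow> inj_on f T"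
  defines "X \<equiv> subtopology (product_topology (\<lambda>_. euclideanreal) T) S"
  shows "continuous_map X (discrete_topology UNIV) (\<lambda>f. restrict (signed_rank T f) T)"
proof -
  let ?\<rho> = "\<lambda>f. restrict (signed_rank T f) T"
  have "\<exists>N. openin X N \<and> f \<in> N \<and> (\<forall>g\<in>N. ?\<rho> g = ?\<rho> f)" if f: "f \<in> topspace X" for f
  proof -
    define P where "P = {(s, t) \<in> T \<times> T. f s < f t}"
    define N where "N = (\<Inter>(s, t)\<in>P. {g \<in> topspace X. g s < g t}) \<inter> topspace X"
    have "finite P"
      using fin by (auto simp: P_def intro: finite_subset[of _ "T \<times> T"])
    moreover have "openin X {g \<in> topspace X. g s < g t}" if "(s, t) \<in> P" for s t
    proof -
      have "continuous_map X euclideanreal (\<lambda>g. g s - g t)"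
        unfolding X_def using that
        by (intro continuous_intros continuous_map_from_subtopology) (auto simp: P_def)
      then show ?thesis
        using openin_continuous_map_preimage[of X euclideanreal "\<lambda>g. g s - g t" "{..<0}"] by simp
    qed
    ultimately have "openin X N"
      unfolding N_def by (intro openin_INT) auto
    moreover have "f \<in> N"
      using f by (auto simp: N_def P_def)
    moreover have "?\<rho> g = ?\<rho> f" if g: "g \<in> N" for g
    proof (rule restrict_ext, rule signed_rank_cong)
      fix s t assume st: "s \<in> T" "t \<in> T"
      have mono: "g u < g v" if "u \<in> T" "v \<in> T" "f u < f v" for u v
        using g that by (auto simp: N_def P_def)
      have "f s \<noteq> f t" if "s \<noteq> t"
        using inj[of f] f st that by (auto simp: X_def inj_on_def)
      then show "g s < g t \<longleftrightarrow> f s < f t"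
        using mono[OF st] mono[OF st(2,1)] by (cases "s = t") (auto simp: neq_iff)
    qed auto
    ultimately show ?thesis
      by blast
  qed
  then have "openin X {f \<in> topspace X. ?\<rho> f \<in> U}" for U
    by (subst openin_subopen) (smt (verit) mem_Collect_eq openin_subset subset_iff)
  then show ?thesis
    by (simp add: continuous_map_def)
qed

text \<open>
  Convexity, for functions whose values off \<open>T\<close> are pinned: the straight line homotopy to a point
  of \<open>S\<close> is restricted to \<open>T\<close>.
\<close>

lemma contractible_space_segment_closed:
  fixes S :: "('a \<Rightarrow> real) set"
  assumes ext: "S \<subseteq> extensional T"
    and segment: "\<And>f g u. \<lbrakk>f \<in> S; g \<in> S; 0 \<le> u; u \<le> 1\<rbrakk>
      \<Longrightarrow> (\<lambda>t\<in>T. (1 - u) * f t + u * g t) \<in> S"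
  shows "contractible_space (subtopology (product_topology (\<lambda>_. euclideanreal) T) S)"
    (is "contractible_space ?X")
proof (cases "S = {}")
  case True
  then show ?thesis
    by simp
next
  case False
  then obtain g where g: "g \<in> S"
    by blast
  let ?h = "\<lambda>(u, f). \<lambda>t\<in>T. (1 - u) * f t + u * g t"
  have top: "topspace ?X = S"
    using ext by (auto simp: PiE_def)
  have "continuous_map (prod_topology (top_of_set {0..1}) ?X) euclideanreal
      (\<lambda>p. ?h p t)" if t: "t \<in> T" for t
  proof -
    have "continuous_map (prod_topology (top_of_set {0..1::real}) ?X) euclideanreal (\<lambda>p. fst p)"
      using continuous_map_fst continuous_map_into_fulltopology by blast
    moreover have "continuous_map (prod_topology (top_of_set {0..1::real}) ?X) euclideanreal (\<lambda>p. snd p t)"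
      using continuous_map_compose[OF continuous_map_snd
          continuous_map_from_subtopology[OF continuous_map_product_projection[OF t]]]
      by (simp add: o_def)
    ultimately show ?thesis
      using t unfolding case_prod_unfold by (simp add: continuous_intros)
  qed
  then have "continuous_map (prod_topology (top_of_set {0..1}) ?X)
      (product_topology (\<lambda>_. euclideanreal) T) ?h"
    by (auto simp: continuous_map_componentwise)
  then have "continuous_map (prod_topology (top_of_set {0..1}) ?X) ?X ?h"
    using segment g by (intro continuous_map_into_subtopology) (auto simp: top)
  then have "homotopic_with (\<lambda>_. True) ?X ?X id (\<lambda>_. g)"
    using ext g
    by (subst homotopic_with) (auto simp: top intro!: exI[of _ ?h] extensional_restrict)
  then show ?thesis
    by (auto simp: contractible_space_def)
qed


section \<open>The involution on a finite \<open>C\<^sub>2\<close>-set\<close>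

text \<open>
  The action of the generator, extended to the whole type as an involution that does not depend
  on \<open>k\<close> and \<open>\<epsilon>\<close>, so that it commutes with the inclusion of the free part.
\<close>

definition flip :: "nat \<times> int + nat \<Rightarrow> nat \<times> int + nat"
  where "flip t = (case t of Inl (i, h) \<Rightarrow> Inl (i, 1 - h) | Inr j \<Rightarrow> Inr j)"

lemma flip_flip [simp]: "flip (flip t) = t"
  by (simp add: flip_def split: sum.splits prod.splits)

lemma flip_in_C2_set [simp]: "flip t \<in> C2_set k \<epsilon> \<longleftrightarrow> t \<in> C2_set k \<epsilon>"
  by (auto simp: flip_def C2_set_def carrier_C2 split: sum.splits)

lemma bij_betw_flip: "bij_betw flip (C2_set k \<epsilon>) (C2_set k \<epsilon>)"
  by (rule bij_betw_byWitness[where f' = flip]) auto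

lemma C2_set_action_eq_flip:
  "t \<in> C2_set k \<epsilon> \<Longrightarrow> C2_set_action k \<epsilon> 0 t = t"
  "t \<in> C2_set k \<epsilon> \<Longrightarrow> C2_set_action k \<epsilon> 1 t = flip t"
  by (auto simp: C2_set_action_def C2_set_def carrier_C2 mult_C2 flip_def)

text \<open>
  As the neutral element acts trivially on both sides, equivariance only concerns the generator.
\<close>

lemma equivariant_C2_set_iff:
  assumes "\<And>t. t \<in> C2_set k \<epsilon> \<Longrightarrow> \<psi> 0 (f t) = f t"
  shows "equivariant C2 (C2_set k \<epsilon>) (C2_set_action k \<epsilon>) \<psi> f \<longleftrightarrow>
    (\<forall>t\<in>C2_set k \<epsilon>. f (flip t) = \<psi> 1 (f t))"
  using assms by (auto simp: equivariant_def carrier_C2 C2_set_action_eq_flip)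

lemma finite_C2_set: "finite (C2_set k \<epsilon>)"
  by (simp add: C2_set_def carrier_C2)

lemma C2_set_free_subset: "C2_set k 0 \<subseteq> C2_set k \<epsilon>"
  by (auto simp: C2_set_def)

text \<open>
  This characterises the free part by the action alone, so it is preserved by any
  bijection commuting with \<open>flip\<close>.
\<close>

lemma C2_set_free_iff: "t \<in> C2_set k \<epsilon> \<Longrightarrow> t \<in> C2_set k 0 \<longleftrightarrow> flip t \<noteq> t"
  by (auto simp: C2_set_def flip_def) presburger


section \<open>Equivariant automorphisms\<close>

lemma group_equivariant_Aut:
  assumes closed: "\<And>g t. \<lbrakk>g \<in> carrier G; t \<in> T\<rbrakk> \<Longrightarrow> \<phi> g t \<in> T"
  shows "group (equivariant_Aut G T \<phi>)"
  unfolding equivariant_Aut_def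
proof (rule subgroup.subgroup_is_group[OF group.subgroupI[OF group_BijGroup] group_BijGroup])
  let ?H = "{a \<in> Bij T. equivariant G T \<phi> \<phi> a}"
  show "?H \<subseteq> carrier (BijGroup T)"
    by (auto simp: BijGroup_def)
  have "(\<lambda>t\<in>T. t) \<in> ?H"
    using closed by (auto simp: id_Bij equivariant_def)
  then show "?H \<noteq> {}"
    by blast
  show "inv\<^bsub>BijGroup T\<^esub> a \<in> ?H" if "a \<in> ?H" for a
  proof -
    have a: "a \<in> Bij T" "bij_betw a T T" "equivariant G T \<phi> \<phi> a"
      using that by (auto simp: Bij_def)
    have inv: "inv_into T a (\<phi> g t) = \<phi> g (inv_into T a t)" if g: "g \<in> carrier G" and t: "t \<in> T" for g t
    proof (rule inv_into_f_eq)
      show "inj_on a T"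
        using a by (simp add: bij_betw_def)
      have mem: "inv_into T a t \<in> T"
        by (rule Bij_inv_into_mem[OF a(1) t])
      show "\<phi> g (inv_into T a t) \<in> T"
        by (rule closed[OF g mem])
      have "a (\<phi> g (inv_into T a t)) = \<phi> g (a (inv_into T a t))"
        using a(3) g mem by (simp add: equivariant_def)
      then show "a (\<phi> g (inv_into T a t)) = \<phi> g t"
        by (simp only: bij_betw_inv_into_right[OF a(2) t])
    qed
    have "equivariant G T \<phi> \<phi> (restrict (inv_into T a) T)"
      using closed inv by (simp add: equivariant_def)
    then show ?thesis
      using restrict_inv_into_Bij[OF a(1)] by (simp add: inv_BijGroup[OF a(1)])
  qed
  show "a \<otimes>\<^bsub>BijGroup T\<^esub> b \<in> ?H" if "a \<in> ?H" "b \<in> ?H" for a b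
    using that closed Bij_imp_funcset[of b T]
    by (auto simp: BijGroup_def compose_Bij equivariant_def compose_eq Pi_iff)
qed

lemma group_Aut_free: "group (Aut_free k)"
  unfolding Aut_free_def by (rule group_equivariant_Aut) (rule C2_set_action_closed)

lemma carrier_Aut_free:
  "carrier (Aut_free k) = {a \<in> Bij (C2_set k 0). \<forall>t\<in>C2_set k 0. a (flip t) = flip (a t)}"
proof -
  have "equivariant C2 (C2_set k 0) (C2_set_action k 0) (C2_set_action k 0) a \<longleftrightarrow>
      (\<forall>t\<in>C2_set k 0. a (flip t) = flip (a t))" if "a \<in> Bij (C2_set k 0)" for a
    using Bij_imp_funcset[OF that]
    by (subst equivariant_C2_set_iff) (auto simp: C2_set_action_eq_flip Pi_iff)
  then show ?thesis
    by (auto simp: Aut_free_def equivariant_Aut_def)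
qed

lemma extend_by_id_Aut_free:
  assumes a: "a \<in> carrier (Aut_free k)"
  shows "bij_betw (extend_by_id k a) (C2_set k \<epsilon>) (C2_set k \<epsilon>)"
    and "extend_by_id k a (flip t) = flip (extend_by_id k a t)"
proof -
  have "bij_betw a (C2_set k 0) (C2_set k 0)"
    using a by (simp add: carrier_Aut_free Bij_def)
  then have "bij_betw (extend_by_id k a) (C2_set k 0) (C2_set k 0)"
    by (simp add: extend_by_id_def cong: bij_betw_cong)
  moreover have "bij_betw (extend_by_id k a) (C2_set k \<epsilon> - C2_set k 0) (C2_set k \<epsilon> - C2_set k 0)"
    by (auto simp: extend_by_id_def bij_betw_def inj_on_def image_iff)
  ultimately have "bij_betw (extend_by_id k a) (C2_set k 0 \<union> (C2_set k \<epsilon> - C2_set k 0))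
      (C2_set k 0 \<union> (C2_set k \<epsilon> - C2_set k 0))"
    by (rule bij_betw_combine) auto
  then show "bij_betw (extend_by_id k a) (C2_set k \<epsilon>) (C2_set k \<epsilon>)"
    by (simp add: Un_absorb1 C2_set_free_subset)
  show "extend_by_id k a (flip t) = flip (extend_by_id k a t)"
    using a by (simp add: carrier_Aut_free extend_by_id_def)
qed

text \<open>
  Extension by the identity reaches every equivariant permutation of the whole set: such a
  permutation preserves the free part and its complement, and the complement has at most
  one point.
\<close>

lemma extend_by_id_surj:
  assumes \<epsilon>: "\<epsilon> \<in> {0, 1}" and bij: "bij_betw \<sigma> (C2_set k \<epsilon>) (C2_set k \<epsilon>)"
    and flip: "\<And>t. t \<in> C2_set k \<epsilon> \<Longrightarrow> \<sigma> (flip t) = flip (\<sigma> t)"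
  obtains a where "a \<in> carrier (Aut_free k)" "\<And>t. t \<in> C2_set k \<epsilon> \<Longrightarrow> extend_by_id k a t = \<sigma> t"
proof
  let ?T = "C2_set k \<epsilon>" and ?F = "C2_set k 0"
  have \<sigma>: "\<sigma> t \<in> ?T" if "t \<in> ?T" for t
    using bij that by (auto simp: bij_betw_def)
  have free: "\<sigma> t \<in> ?F \<longleftrightarrow> t \<in> ?F" if t: "t \<in> ?T" for t
  proof -
    have "\<sigma> t \<in> ?F \<longleftrightarrow> \<sigma> (flip t) \<noteq> \<sigma> t"
      using C2_set_free_iff[OF \<sigma>[OF t]] flip[OF t] by simp
    also have "\<dots> \<longleftrightarrow> flip t \<noteq> t"
      using inj_on_eq_iff[OF bij_betw_imp_inj_on[OF bij], of "flip t" t] t by simp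
    finally show ?thesis
      using C2_set_free_iff[OF t] by simp
  qed
  have "bij_betw \<sigma> ?F ?F"
  proof (rule bij_betw_subset[OF bij C2_set_free_subset])
    show "\<sigma> ` ?F = ?F"
    proof (intro equalityI subsetI)
      fix t assume t: "t \<in> ?F"
      then obtain s where "s \<in> ?T" "t = \<sigma> s"
        using bij C2_set_free_subset[of k \<epsilon>] by (auto simp: bij_betw_def)
      with t free show "t \<in> \<sigma> ` ?F"
        by blast
    qed (use free C2_set_free_subset in blast)
  qed
  then show "restrict \<sigma> ?F \<in> carrier (Aut_free k)"
    using flip C2_set_free_subset[of k \<epsilon>] by (auto simp: carrier_Aut_free Bij_def)
  show "extend_by_id k (restrict \<sigma> ?F) t = \<sigma> t" if t: "t \<in> ?T" for t
  proof (cases "t \<in> ?F")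
    case False
    have "s = Inr 0" if "s \<in> ?T" "s \<notin> ?F" for s
      using \<epsilon> that by (auto simp: C2_set_def)
    then show ?thesis
      using False t \<sigma>[OF t] free[OF t] by (metis extend_by_id_def)
  qed (simp add: extend_by_id_def)
qed


section \<open>Equivariant embeddings into the sign representation\<close>

lemma Emb_sign_eq_subtopology:
  "Emb_sign k \<epsilon> = subtopology (product_topology (\<lambda>_. euclideanreal) (C2_set k \<epsilon>))
    {f \<in> extensional (C2_set k \<epsilon>). inj_on f (C2_set k \<epsilon>) \<and> (\<forall>t\<in>C2_set k \<epsilon>. f (flip t) = - f t)}"
proof -
  have "equivariant C2 (C2_set k \<epsilon>) (C2_set_action k \<epsilon>) sign_rep f \<longleftrightarrow>
      (\<forall>t\<in>C2_set k \<epsilon>. f (flip t) = - f t)" for f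
    by (subst equivariant_C2_set_iff) (auto simp: sign_rep_def)
  then show ?thesis
    by (simp add: Emb_sign_def equivariant_Emb_def PiE_def Int_def)
qed

lemma topspace_Emb_sign:
  "topspace (Emb_sign k \<epsilon>) = {f \<in> extensional (C2_set k \<epsilon>).
    inj_on f (C2_set k \<epsilon>) \<and> (\<forall>t\<in>C2_set k \<epsilon>. f (flip t) = - f t)}"
  by (auto simp: Emb_sign_eq_subtopology PiE_def)

lemma Emb_sign_nonempty:
  assumes "\<epsilon> \<in> {0, 1}"
  shows "topspace (Emb_sign k \<epsilon>) \<noteq> {}"
proof -
  \<comment> \<open>The \<open>i\<close>-th free orbit goes to \<open>{1 + i, - (1 + i)}\<close>, and a fixed point to the origin.\<close>
  define f :: "nat \<times> int + nat \<Rightarrow> real" where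
    "f = (\<lambda>t\<in>C2_set k \<epsilon>. case t of Inl (i, h) \<Rightarrow> (1 - 2 * of_int h) * (1 + real i) | Inr j \<Rightarrow> 0)"
  have "f \<in> topspace (Emb_sign k \<epsilon>)"
    using assms
    by (auto simp: topspace_Emb_sign f_def flip_def inj_on_def C2_set_def carrier_C2 split: sum.splits)
  then show ?thesis
    by blast
qed

lemma precompose_apply: "t \<in> C2_set k \<epsilon> \<Longrightarrow> precompose k \<epsilon> f a t = f (extend_by_id k a t)"
  by (simp add: precompose_def compose_eq)

lemma precompose_in_Emb_sign:
  assumes f: "f \<in> topspace (Emb_sign k \<epsilon>)" and a: "a \<in> carrier (Aut_free k)"
  shows "precompose k \<epsilon> f a \<in> topspace (Emb_sign k \<epsilon>)"
proof -
  note ext = extend_by_id_Aut_free(1)[OF a, of \<epsilon>]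
  have "inj_on (f \<circ> extend_by_id k a) (C2_set k \<epsilon>)"
    using f ext by (auto simp: topspace_Emb_sign bij_betw_def intro!: comp_inj_on)
  then have "inj_on (precompose k \<epsilon> f a) (C2_set k \<epsilon>)"
    by (simp add: precompose_apply cong: inj_on_cong)
  moreover have "precompose k \<epsilon> f a (flip t) = - precompose k \<epsilon> f a t" if "t \<in> C2_set k \<epsilon>" for t
    using f that bij_betw_apply[OF ext that]
    by (simp add: precompose_apply extend_by_id_Aut_free(2)[OF a] topspace_Emb_sign)
  ultimately show ?thesis
    by (simp add: topspace_Emb_sign precompose_def)
qed

lemma continuous_right_action_precompose:
  "continuous_right_action (Aut_free k) (Emb_sign k \<epsilon>) (precompose k \<epsilon>)"
  unfolding continuous_right_action_def
proof (intro conjI ballI)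
  show "group (Aut_free k)"
    by (rule group_Aut_free)
next
  fix a assume a: "a \<in> carrier (Aut_free k)"
  have "continuous_map (Emb_sign k \<epsilon>) euclideanreal (\<lambda>f. precompose k \<epsilon> f a t)"
    if t: "t \<in> C2_set k \<epsilon>" for t
    unfolding precompose_apply[OF t] Emb_sign_eq_subtopology
    using bij_betw_apply[OF extend_by_id_Aut_free(1)[OF a] t]
    by (intro continuous_map_from_subtopology continuous_map_product_projection)
  then have "continuous_map (Emb_sign k \<epsilon>) (product_topology (\<lambda>_. euclideanreal) (C2_set k \<epsilon>))
      (\<lambda>f. precompose k \<epsilon> f a)"
    by (auto simp: continuous_map_componentwise precompose_def compose_def)
  then show "continuous_map (Emb_sign k \<epsilon>) (Emb_sign k \<epsilon>) (\<lambda>f. precompose k \<epsilon> f a)"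
    using precompose_in_Emb_sign[OF _ a]
    by (subst (2) Emb_sign_eq_subtopology, intro continuous_map_into_subtopology)
       (auto simp: topspace_Emb_sign)
next
  fix f assume f: "f \<in> topspace (Emb_sign k \<epsilon>)"
  show "precompose k \<epsilon> f \<one>\<^bsub>Aut_free k\<^esub> = f"
    using f by (intro extensionalityI[where A = "C2_set k \<epsilon>"])
      (auto simp: topspace_Emb_sign precompose_def compose_eq extend_by_id_def
        Aut_free_def equivariant_Aut_def BijGroup_def)
  fix a b assume a: "a \<in> carrier (Aut_free k)" and b: "b \<in> carrier (Aut_free k)"
  have ab: "a \<in> Bij (C2_set k 0)" "b \<in> Bij (C2_set k 0)"
    using a b by (simp_all add: carrier_Aut_free)
  have "extend_by_id k (a \<otimes>\<^bsub>Aut_free k\<^esub> b) t = extend_by_id k a (extend_by_id k b t)" for t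
    using ab Bij_imp_funcset[OF ab(2)]
    by (auto simp: Aut_free_def equivariant_Aut_def BijGroup_def extend_by_id_def compose_eq)
  then show "precompose k \<epsilon> f (a \<otimes>\<^bsub>Aut_free k\<^esub> b) = precompose k \<epsilon> (precompose k \<epsilon> f a) b"
    using bij_betw_apply[OF extend_by_id_Aut_free(1)[OF b]]
    by (intro extensionalityI[where A = "C2_set k \<epsilon>"])
       (simp_all add: precompose_apply, simp_all add: precompose_def)
qed

text \<open>
  Since \<open>f \<circ> flip = - f\<close>, reindexing by \<open>flip\<close> reverses the order.
\<close>

lemma signed_rank_flip:
  assumes f: "f \<in> topspace (Emb_sign k \<epsilon>)" and t: "t \<in> C2_set k \<epsilon>"
  shows "signed_rank (C2_set k \<epsilon>) f (flip t) = - signed_rank (C2_set k \<epsilon>) f t"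
proof -
  have "signed_rank (C2_set k \<epsilon>) f (flip t) = signed_rank (C2_set k \<epsilon>) (\<lambda>s. f (flip s)) t"
    by (simp add: signed_rank_reindex bij_betw_flip)
  also have "\<dots> = signed_rank (C2_set k \<epsilon>) (\<lambda>s. - f s) t"
    using f t by (intro signed_rank_cong) (auto simp: topspace_Emb_sign)
  finally show ?thesis
    by (simp add: signed_rank_uminus)
qed

lemma signed_rank_precompose:
  assumes "a \<in> carrier (Aut_free k)" "t \<in> C2_set k \<epsilon>"
  shows "signed_rank (C2_set k \<epsilon>) (precompose k \<epsilon> f a) t
    = signed_rank (C2_set k \<epsilon>) f (extend_by_id k a t)"
proof -
  have "signed_rank (C2_set k \<epsilon>) (precompose k \<epsilon> f a) t
      = signed_rank (C2_set k \<epsilon>) (\<lambda>s. f (extend_by_id k a s)) t"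
    using assms(2) by (intro signed_rank_cong) (auto simp: precompose_apply)
  then show ?thesis
    by (simp add: signed_rank_reindex extend_by_id_Aut_free(1)[OF assms(1)])
qed

text \<open>
  Matching points of equal rank is the only candidate for a permutation \<open>\<sigma>\<close>. It is equivariant
  because the ranks of \<open>flip t\<close> under \<open>f\<close> and \<open>g\<close> are the negatives of those of \<open>t\<close>.
\<close>

lemma signed_rank_simply_transitive:
  assumes \<epsilon>: "\<epsilon> \<in> {0, 1}"
    and f: "f \<in> topspace (Emb_sign k \<epsilon>)" and g: "g \<in> topspace (Emb_sign k \<epsilon>)"
  defines "T \<equiv> C2_set k \<epsilon>"
  shows "\<exists>!a. a \<in> carrier (Aut_free k) \<and>
    (\<forall>t\<in>T. signed_rank T f (extend_by_id k a t) = signed_rank T g t)"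
proof -
  have fin: "finite T" and inj: "inj_on f T" "inj_on g T"
    using f g by (simp_all add: T_def finite_C2_set topspace_Emb_sign)
  let ?R = "(\<lambda>j. 2 * int j + 1 - int (card T)) ` {..<card T}"
  have rf: "bij_betw (signed_rank T f) T ?R" and rg: "bij_betw (signed_rank T g) T ?R"
    using bij_betw_signed_rank fin inj by blast+
  note inj_rf = inj_on_eq_iff[OF bij_betw_imp_inj_on[OF rf]]
  define \<sigma> where "\<sigma> = inv_into T (signed_rank T f) \<circ> signed_rank T g"
  have bij: "bij_betw \<sigma> T T"
    unfolding \<sigma>_def by (rule bij_betw_trans[OF rg bij_betw_inv_into[OF rf]])
  have \<sigma>: "signed_rank T f (\<sigma> t) = signed_rank T g t" if "t \<in> T" for t
    using bij_betw_inv_into_right[OF rf bij_betw_apply[OF rg that]] by (simp add: \<sigma>_def)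
  have flip: "\<sigma> (flip t) = flip (\<sigma> t)" if t: "t \<in> T" for t
  proof -
    have mem: "flip t \<in> T" "\<sigma> t \<in> T" "flip (\<sigma> t) \<in> T" "\<sigma> (flip t) \<in> T"
      using t bij_betw_apply[OF bij] by (simp_all add: T_def)
    have "signed_rank T f (\<sigma> (flip t)) = signed_rank T f (flip (\<sigma> t))"
      using signed_rank_flip[OF g] signed_rank_flip[OF f] \<sigma> t mem by (simp add: T_def)
    then show ?thesis
      using inj_rf mem by simp
  qed
  obtain a where a: "a \<in> carrier (Aut_free k)" "\<And>t. t \<in> T \<Longrightarrow> extend_by_id k a t = \<sigma> t"
    using extend_by_id_surj[OF \<epsilon>, of \<sigma> k] bij flip unfolding T_def by blast
  show ?thesis
  proof (intro ex1I[of _ a] conjI ballI)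
    fix b assume b: "b \<in> carrier (Aut_free k) \<and>
      (\<forall>t\<in>T. signed_rank T f (extend_by_id k b t) = signed_rank T g t)"
    show "b = a"
    proof (rule extensionalityI[where A = "C2_set k 0"])
      show "b \<in> extensional (C2_set k 0)" "a \<in> extensional (C2_set k 0)"
        using a b by (simp_all add: carrier_Aut_free Bij_def)
      fix t assume t: "t \<in> C2_set k 0"
      then have tT: "t \<in> T"
        using C2_set_free_subset by (auto simp: T_def)
      have "signed_rank T f (extend_by_id k b t) = signed_rank T f (\<sigma> t)"
        using b \<sigma> tT by simp
      moreover have "extend_by_id k b t \<in> T"
        using b tT bij_betw_apply[OF extend_by_id_Aut_free(1)] unfolding T_def by blast
      ultimately have "extend_by_id k b t = \<sigma> t"
        using inj_rf bij_betw_apply[OF bij tT] by simp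
      then show "b t = a t"
        using a(2)[OF tT] t by (simp add: extend_by_id_def)
    qed
  qed (use a \<sigma> in simp_all)
qed

text \<open>
  Two embeddings with the same ranks induce the same order on \<open>T\<close>, so every convex combination
  of them also induces this order and in particular is injective; oddness is a linear
  condition.
\<close>

lemma contractible_signed_rank_fibre:
  fixes k \<epsilon> :: nat
  defines "T \<equiv> C2_set k \<epsilon>"
  shows "contractible_space (subtopology (Emb_sign k \<epsilon>)
    (fibre (Emb_sign k \<epsilon>) (\<lambda>f. restrict (signed_rank T f) T) r))"
proof -
  let ?S = "fibre (Emb_sign k \<epsilon>) (\<lambda>f. restrict (signed_rank T f) T) r"
  have "contractible_space (subtopology (product_topology (\<lambda>_. euclideanreal) T) ?S)"
  proof (rule contractible_space_segment_closed)
    show "?S \<subseteq> extensional T"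
      by (auto simp: topspace_Emb_sign T_def)
    fix f g and u :: real
    assume f: "f \<in> ?S" and g: "g \<in> ?S" and u: "0 \<le> u" "u \<le> 1"
    define h where "h = (\<lambda>t\<in>T. (1 - u) * f t + u * g t)"
    have h_eq: "h t = (1 - u) * f t + u * g t" if "t \<in> T" for t
      using that by (simp add: h_def)
    have "signed_rank T f t = signed_rank T g t" if "t \<in> T" for t
      using f g that by (auto dest: fun_cong[where x = t])
    then have order: "f s < f t \<longleftrightarrow> g s < g t" if "s \<in> T" "t \<in> T" for s t
      using that signed_rank_eq_imp_less_iff[OF finite_C2_set] unfolding T_def by blast
    have mono: "h s < h t" if st: "s \<in> T" "t \<in> T" "f s < f t" for s t
    proof -
      have "g s < g t"
        using order st by blast
      \<comment> \<open>One of the weights \<open>1 - u\<close> and \<open>u\<close> is positive, and both differences are.\<close>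
      have "0 < (1 - u) * (f t - f s) + u * (g t - g s)"
      proof (cases "u = 1")
        case False
        then show ?thesis
          using u st(3) \<open>g s < g t\<close> by (intro add_pos_nonneg mult_pos_pos mult_nonneg_nonneg) auto
      qed (use \<open>g s < g t\<close> in simp)
      then show ?thesis
        using st by (simp add: h_eq algebra_simps)
    qed
    have inj_f: "inj_on f T"
      using f by (simp add: topspace_Emb_sign T_def)
    have h_order: "h s < h t \<longleftrightarrow> f s < f t" if "s \<in> T" "t \<in> T" for s t
      using mono[OF that] mono[OF that(2,1)] inj_onD[OF inj_f _ that]
      by (cases "f s" "f t" rule: linorder_cases) auto
    have "inj_on h T"
      using mono inj_f by (intro inj_onI) (metis inj_onD linorder_neqE_linordered_idom order_less_irrefl)
    moreover have "h (flip t) = - h t" if t: "t \<in> T" for t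
    proof -
      have "f (flip t) = - f t" "g (flip t) = - g t" "flip t \<in> T"
        using f g t by (simp_all add: topspace_Emb_sign T_def)
      then show ?thesis
        using t by (simp add: h_eq algebra_simps)
    qed
    moreover have "restrict (signed_rank T h) T = restrict (signed_rank T f) T"
      by (rule restrict_ext) (rule signed_rank_cong, use h_order in auto)
    ultimately show "(\<lambda>t\<in>T. (1 - u) * f t + u * g t) \<in> ?S"
      using f unfolding h_def[symmetric] by (simp add: topspace_Emb_sign T_def h_def)
  qed
  moreover have "subtopology (Emb_sign k \<epsilon>) ?S = subtopology (product_topology (\<lambda>_. euclideanreal) T) ?S"
  proof -
    have "?S \<subseteq> topspace (Emb_sign k \<epsilon>)"
      by blast
    then show ?thesis
      by (simp add: Emb_sign_eq_subtopology[of k \<epsilon>] subtopology_subtopology topspace_Emb_sign T_def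
          Int_absorb1)
  qed
  ultimately show ?thesis
    by simp
qed

theorem proposition2p29:
  fixes k \<epsilon> :: nat
  assumes "\<epsilon> \<in> {0, 1}"
  shows "homotopy_discrete_torsor (Aut_free k) (Emb_sign k \<epsilon>) (precompose k \<epsilon>) \<and>
         Emb_sign k \<epsilon> homotopy_equivalent_space discrete_topology (carrier (Aut_free k))"
proof -
  define T where "T = C2_set k \<epsilon>"
  define \<rho> where "\<rho> = (\<lambda>f :: nat \<times> int + nat \<Rightarrow> real. restrict (signed_rank T f) T)"
  have \<rho>_eq_iff: "\<rho> f = \<rho> g \<longleftrightarrow> (\<forall>t\<in>T. signed_rank T f t = signed_rank T g t)" for f g
    by (auto simp: \<rho>_def restrict_def fun_eq_iff)
  have \<rho>_act: "signed_rank T (precompose k \<epsilon> f a) t = signed_rank T f (extend_by_id k a t)"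
    if "a \<in> carrier (Aut_free k)" "t \<in> T" for f a t
    using that signed_rank_precompose unfolding T_def by blast
  have cont: "continuous_map (Emb_sign k \<epsilon>) (discrete_topology UNIV) \<rho>"
    unfolding Emb_sign_eq_subtopology \<rho>_def T_def
    by (rule continuous_map_signed_rank) (auto simp: finite_C2_set)
  have contr: "contractible_space (subtopology (Emb_sign k \<epsilon>) (fibre (Emb_sign k \<epsilon>) \<rho> r))" for r
    unfolding \<rho>_def T_def by (rule contractible_signed_rank_fibre)
  have cong: "\<rho> (precompose k \<epsilon> f a) = \<rho> (precompose k \<epsilon> g a)"
    if a: "a \<in> carrier (Aut_free k)" and "\<rho> f = \<rho> g" for f g a
  proof -
    have "extend_by_id k a t \<in> T" if "t \<in> T" for t
      using that bij_betw_apply[OF extend_by_id_Aut_free(1)[OF a]] unfolding T_def by blast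
    then show ?thesis
      using \<open>\<rho> f = \<rho> g\<close> unfolding \<rho>_eq_iff by (simp add: \<rho>_act[OF a])
  qed
  have trans: "\<exists>!a. a \<in> carrier (Aut_free k) \<and> \<rho> (precompose k \<epsilon> f a) = \<rho> g"
    if f: "f \<in> topspace (Emb_sign k \<epsilon>)" and g: "g \<in> topspace (Emb_sign k \<epsilon>)" for f g
  proof -
    have "a \<in> carrier (Aut_free k) \<and> \<rho> (precompose k \<epsilon> f a) = \<rho> g \<longleftrightarrow>
        a \<in> carrier (Aut_free k) \<and>
        (\<forall>t\<in>T. signed_rank T f (extend_by_id k a t) = signed_rank T g t)" for a
      by (auto simp: \<rho>_eq_iff \<rho>_act)
    then show ?thesis
      using signed_rank_simply_transitive[OF assms f g] unfolding T_def by simp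
  qed
  show ?thesis
    using torsor_of_fibrewise_simply_transitive[OF continuous_right_action_precompose cont contr
        cong trans Emb_sign_nonempty[OF assms]]
    by blast
qed

end
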